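(* There are infinitely many quartic algebraic integers $\alpha$, i.e. roots of $\alpha^4+a\alpha^3+b\alpha^2+c\alpha+d=0$ with $a,b,c,d\in\mathbb{Z}$ where $\alpha$ has degree $4$ over $\mathbb{Q}$, for which $$\beta=\frac{4\alpha^4}{\alpha^4-1}-\frac{\alpha}{\alpha-1}$$ is a quadratic algebraic number. Moreover, there are infinitely many quartic algebraic numbers $\alpha$ (algebraic numbers of degree $4$ over $\mathbb{Q}$) such that the corresponding $\beta=\frac{4\alpha^4}{\alpha^4-1}-\frac{\alpha}{\alpha-1}$ is a real quadratic algebraic number.
   Context: A quadratic algebraic number is an algebraic number of degree $2$ over $\mathbb{Q}$; it is real quadratic if it is a real number of degree $2$ over $\mathbb{Q}$. *)

theory Defs
  imports Complex_Main "HOL-Computational_Algebra.Computational_Algebra"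
begin

definition is_minimal_poly_rat :: "rat poly \<Rightarrow> complex \<Rightarrow> bool" where
  "is_minimal_poly_rat p x \<longleftrightarrow>
     lead_coeff p = 1 \<and> irreducible p \<and> poly (map_poly of_rat p) x = 0"

definition algebraic_of_degree :: "nat \<Rightarrow> complex \<Rightarrow> bool" where
  "algebraic_of_degree n x \<longleftrightarrow> (\<exists>p. is_minimal_poly_rat p x \<and> degree p = n)"

(* The denominators vanish only at fourth roots of unity, which have degree at most 2,
   so the convention x / 0 = 0 plays no role for arguments of degree 4. *)
definition beta_of :: "complex \<Rightarrow> complex" where
  "beta_of \<alpha> = 4 * \<alpha> ^ 4 / (\<alpha> ^ 4 - 1) - \<alpha> / (\<alpha> - 1)"

end

theory Submission
  imports Defs
begin

text \<open>
  Cancelling \<open>\<alpha> - 1\<close> gives \<open>\<beta> = f \<alpha>\<close> with \<open>f x = (3x\<^sup>3 + 2x\<^sup>2 + x) / (x\<^sup>3 + x\<^sup>2 + x + 1)\<close>. As \<open>f\<close> has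
  degree 3, \<open>\<beta>\<close> is quadratic for a quartic \<open>\<alpha>\<close> only if \<open>f \<alpha> = f \<gamma>\<close> for some \<open>\<gamma> \<noteq> \<alpha>\<close> in
  \<open>\<rat>(\<beta>)\<close>, which is a quadratic equation for \<open>\<alpha>\<close> over \<open>\<rat>(\<gamma>)\<close>. With \<open>\<gamma> = p / (n + 1) - 1\<close> and
  \<open>p\<^sup>2 = 2 - 2n\<^sup>2\<close>, \<open>n\<close> rational, it becomes \<open>\<alpha>\<^sup>2 + (1 - n)\<alpha> + 2 - n = p\<close>, so that \<open>\<alpha>\<close> is a root of
  \<open>(x\<^sup>2 + (1 - n)x + 2 - n)\<^sup>2 - (2 - 2n\<^sup>2)\<close>. If \<open>n\<close> is 3-adically divisible by 3, two nonsquare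
  conditions modulo 3 show that this quartic is irreducible. Integers \<open>n\<close> give algebraic integers
  \<open>\<alpha>\<close>, and \<open>\<bar>n\<bar> < 1\<close> gives real \<open>\<beta>\<close>.
\<close>

section \<open>Irreducibility criteria over a field\<close>

lemma irreducible_poly_if_no_small_monic_factor:
  fixes p :: "'a::field poly"
  assumes "degree p > 0"
    and no_factor: "\<And>q. q dvd p \<Longrightarrow> lead_coeff q = 1 \<Longrightarrow> 0 < degree q \<Longrightarrow> 2 * degree q \<le> degree p \<Longrightarrow> False"
  shows "irreducible p"
proof (rule irreducibleI)
  show "p \<noteq> 0" using assms(1) by auto
  then show "\<not> p dvd 1" using assms(1) by (simp add: is_unit_iff_degree)
  fix a b assume p: "p = a * b"
  with \<open>p \<noteq> 0\<close> have nz: "a \<noteq> 0" "b \<noteq> 0" by auto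
  \<comment> \<open>Dividing by the leading coefficient makes any nonzero factor monic, so
    \<open>no_factor\<close> applies; two nonconstant factors cannot both exceed half the
    degree.\<close>
  have small: "degree q = 0 \<or> 2 * degree q > degree p" if "q dvd p" for q
  proof (rule ccontr)
    assume "\<not> ?thesis"
    moreover have "q \<noteq> 0" using that \<open>p \<noteq> 0\<close> by auto
    ultimately show False
      using no_factor[of "smult (inverse (lead_coeff q)) q"] that
      by (auto simp: smult_dvd_iff)
  qed
  have "degree p = degree a + degree b" using nz p by (simp add: degree_mult_eq)
  moreover have "degree a = 0 \<or> 2 * degree a > degree p" "degree b = 0 \<or> 2 * degree b > degree p"
    using p by (intro small; simp)+
  ultimately have "degree a = 0 \<or> degree b = 0" by linarith
  then show "a dvd 1 \<or> b dvd 1" using nz by (simp add: is_unit_iff_degree)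
qed

lemma poly_eq_coeffs_degree_le_2:
  assumes "degree q \<le> 2"
  shows "q = [:coeff q 0, coeff q 1, coeff q 2:]"
proof (rule poly_eqI)
  fix i :: nat
  consider "i = 0" | "i = 1" | "i = 2" | "i > 2" by linarith
  then show "coeff q i = coeff [:coeff q 0, coeff q 1, coeff q 2:] i"
    using assms
    by cases (auto simp: numeral_2_eq_2 coeff_pCons coeff_eq_0 split: nat.split)
qed

lemma monic_degree_1E:
  assumes "lead_coeff q = 1" "degree q = 1"
  obtains b where "q = [:b, 1:]"
proof
  have "coeff q 1 = 1" "coeff q 2 = 0" using assms by (auto simp: coeff_eq_0)
  then show "q = [:coeff q 0, 1:]" using poly_eq_coeffs_degree_le_2[of q] assms(2) by simp
qed

text \<open>The polynomial is \<open>(x - A)\<^sup>2 - C\<close> expanded, so a root would exhibit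
  \<open>C\<close> as a square.\<close>

lemma irreducible_quadratic:
  fixes A C :: "'a::field"
  assumes "\<And>r. r\<^sup>2 \<noteq> C"
  shows "irreducible [:A\<^sup>2 - C, -2 * A, 1:]"
proof (rule irreducible_poly_if_no_small_monic_factor)
  fix q :: "'a poly"
  assume q: "q dvd [:A\<^sup>2 - C, -2 * A, 1:]" "lead_coeff q = 1" "0 < degree q"
    "2 * degree q \<le> degree [:A\<^sup>2 - C, -2 * A, 1:]"
  then have "degree q = 1" by simp
  then obtain b where "q = [:b, 1:]" using q monic_degree_1E by blast
  then have "poly [:A\<^sup>2 - C, -2 * A, 1:] (-b) = 0"
    using q(1) by (simp only: poly_eq_0_iff_dvd minus_minus)
  then have "(b + A)\<^sup>2 = C" by (simp add: power2_eq_square algebra_simps)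
  with assms show False by blast
qed simp

text \<open>The polynomial is \<open>(x\<^sup>2 + e x + f)\<^sup>2 - D\<close> expanded. Over the
  field with a square root of \<open>D\<close> it splits into two conjugate quadratics;
  \<open>disc\<close> says that the norm of their discriminants is not a square.\<close>

lemma irreducible_shifted_square:
  fixes e f D :: rat
  assumes D: "\<And>r. r\<^sup>2 \<noteq> D" and disc: "\<And>r. r\<^sup>2 \<noteq> (4 * f - e\<^sup>2)\<^sup>2 - 16 * D"
  shows "irreducible [:f\<^sup>2 - D, 2 * e * f, e\<^sup>2 + 2 * f, 2 * e, 1:]" (is "irreducible ?F")
proof (rule irreducible_poly_if_no_small_monic_factor)
  fix q :: "rat poly"
  assume q: "q dvd ?F" "lead_coeff q = 1" "0 < degree q" "2 * degree q \<le> degree ?F"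
  then consider "degree q = 1" | "degree q = 2" by fastforce
  then show False
  proof cases
    case 1
    then obtain b where "q = [:b, 1:]" using q monic_degree_1E by blast
    then have "poly ?F (-b) = 0"
      using q(1) by (simp only: poly_eq_0_iff_dvd minus_minus)
    then have "(b\<^sup>2 - e * b + f)\<^sup>2 = D" by (simp add: power2_eq_square algebra_simps)
    with D show False by blast
  next
    case 2
    obtain r where r: "?F = q * r" using q(1) by (rule dvdE)
    have "q \<noteq> 0" "r \<noteq> 0" using r by auto
    then have "degree ?F = degree q + degree r" using r by (simp add: degree_mult_eq)
    then have "degree r = 2" using 2 by simp
    then obtain a b c d g where qr: "q = [:b, a, 1:]" "r = [:d, c, g:]"
      using 2 q(2) poly_eq_coeffs_degree_le_2[of q] poly_eq_coeffs_degree_le_2[of r]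
      by (metis order_refl)
    have "q * r = [:b * d, b * c + a * d, b * g + a * c + d, a * g + c, g:]"
      unfolding qr by (simp add: algebra_simps)
    then have "g = 1" "2 * e = a * g + c" "e\<^sup>2 + 2 * f = b * g + a * c + d"
      "2 * e * f = b * c + a * d" "f\<^sup>2 - D = b * d"
      unfolding r[symmetric] pCons_eq_iff by blast+
    then have a: "a + c = 2 * e" and b: "b + d + a * c = e\<^sup>2 + 2 * f"
      and c: "a * d + b * c = 2 * e * f" and d: "b * d = f\<^sup>2 - D"
      by algebra+
    \<comment> \<open>The linear coefficients of the two quadratic factors add up to
      \<open>2 * e\<close>, so \<open>t\<close> is their deviation from the mean.\<close>
    define t where "t = a - e"
    have ac: "a = e + t" "c = e - t" using a by (auto simp: t_def)
    have bd: "b + d = 2 * f + t\<^sup>2"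
      using b unfolding ac by (simp add: power2_eq_square algebra_simps)
    have "t * (e * t - (b - d)) = e * (b + d) - t * (b - d) - 2 * e * f"
      unfolding bd by (simp add: power2_eq_square algebra_simps)
    also have "\<dots> = 0" using c unfolding ac by (simp add: algebra_simps)
    finally consider "t = 0" | "b - d = e * t" by auto
    then show False
    proof cases
      case 1
      then have "b + d = 2 * f" using bd by simp
      then have "(b - d)\<^sup>2 = 4 * D" using d by algebra
      then have "((b - d) / 2)\<^sup>2 = D" by (simp add: power2_eq_square field_simps)
      with D show False by blast
    next
      case 2
      have "(b + d)\<^sup>2 - (b - d)\<^sup>2 = 4 * (b * d)" by (simp add: power2_eq_square algebra_simps)
      then have "(2 * f + t\<^sup>2)\<^sup>2 - (e * t)\<^sup>2 = 4 * (f\<^sup>2 - D)" unfolding bd 2 d .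
      \<comment> \<open>The equation is quadratic in \<open>t\<^sup>2\<close>; this completes the
        square.\<close>
      then have "(2 * t\<^sup>2 + 4 * f - e\<^sup>2)\<^sup>2 = (4 * f - e\<^sup>2)\<^sup>2 - 16 * D" by algebra
      with disc show False by blast
    qed
  qed
qed simp

lemma of_real_of_rat: "of_real (of_rat q) = (of_rat q :: 'a::{real_field, field_char_0})"
  by (cases q) (simp add: of_rat_rat)

section \<open>Nonsquares modulo 3\<close>

lemma rat_square_not_2_mod_3:
  fixes r :: rat
  assumes "k mod 3 = 2"
  shows "r\<^sup>2 \<noteq> of_int k"
proof
  assume r: "r\<^sup>2 = of_int k"
  obtain a b where ab: "quotient_of r = (a, b)" by fastforce
  then have "b > 0" "coprime a b" "r * of_int b = of_int a"
    using quotient_of_denom_pos quotient_of_coprime quotient_of_div by fastforce+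
  then have "(of_int (a\<^sup>2) :: rat) = of_int (k * b\<^sup>2)"
    using r by (metis of_int_mult of_int_power power_mult_distrib)
  then have "a\<^sup>2 = k * b\<^sup>2" using of_int_eq_iff by blast
  \<comment> \<open>Since 2 is not a square modulo 3, this forces 3 to divide both \<open>a\<close>
    and \<open>b\<close>.\<close>
  then have "a\<^sup>2 mod 3 = (2 * b\<^sup>2) mod 3" using assms by (metis mod_mult_left_eq)
  then have "((a mod 3)\<^sup>2) mod 3 = (2 * ((b mod 3)\<^sup>2 mod 3)) mod 3"
    by (simp add: power_mod mod_mult_right_eq)
  moreover have "a mod 3 \<in> {0, 1, 2}" "b mod 3 \<in> {0, 1, 2}" by auto
  ultimately have "a mod 3 = 0 \<and> b mod 3 = 0" by auto
  then have "3 dvd a" "3 dvd b" by auto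
  with \<open>coprime a b\<close> show False using coprime_common_divisor by fastforce
qed

text \<open>This encodes that \<open>n\<close> is 3-adically divisible by 3. The fraction need not
  be in lowest terms.\<close>

locale quartic_parameter =
  fixes n :: rat and u v :: int
  assumes n_eq: "n = of_int (3 * u) / of_int v" and not_dvd: "\<not> 3 dvd v"
begin

lemma v_square_mod: "v\<^sup>2 mod 3 = 1"
proof -
  have "v mod 3 \<in> {1, 2}" using not_dvd by (auto simp: dvd_eq_mod_eq_0)
  then have "(v mod 3)\<^sup>2 mod 3 = 1" by auto
  then show ?thesis by (simp add: power_mod)
qed

lemma n_times_v: "n * of_int v = 3 * of_int u"
  using not_dvd by (auto simp: n_eq)

text \<open>Multiplied by \<open>v\<^sup>2\<close>, the right side is an integer congruent to
  \<open>2 * v\<^sup>2\<close>, hence to 2, modulo 3.\<close>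

lemma D_not_square: "r\<^sup>2 \<noteq> 2 - 2 * n\<^sup>2"
proof
  assume r: "r\<^sup>2 = 2 - 2 * n\<^sup>2"
  have "(r * of_int v)\<^sup>2 = 2 * (of_int v)\<^sup>2 - 2 * (n * of_int v)\<^sup>2"
    unfolding power_mult_distrib r by (simp add: algebra_simps)
  also have "\<dots> = of_int (2 * v\<^sup>2 + 3 * (- 6 * u\<^sup>2))"
    unfolding n_times_v by (simp add: power2_eq_square)
  finally have "(r * of_int v)\<^sup>2 = of_int (2 * v\<^sup>2 + 3 * (- 6 * u\<^sup>2))" .
  moreover have "(2 * v\<^sup>2 + 3 * (- 6 * u\<^sup>2)) mod 3 = 2" using v_square_mod by presburger
  ultimately show False using rat_square_not_2_mod_3 by blast
qed

lemma disc_not_square: "r\<^sup>2 \<noteq> (4 * (2 - n) - (1 - n)\<^sup>2)\<^sup>2 - 16 * (2 - 2 * n\<^sup>2)"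
proof
  assume r: "r\<^sup>2 = (4 * (2 - n) - (1 - n)\<^sup>2)\<^sup>2 - 16 * (2 - 2 * n\<^sup>2)"
  let ?V = "of_int v :: rat" and ?U = "of_int u :: rat"
  \<comment> \<open>At \<open>n = 0\<close> the right side of \<open>r\<close> is 17. After clearing
    denominators, every other term contains \<open>n * v = 3 * u\<close>; \<open>3 * k\<close>
    collects these terms.\<close>
  define k where "k = u * (27 * u ^ 3 + 36 * u\<^sup>2 * v - 30 * u * v\<^sup>2 - 28 * v ^ 3 + 96 * u * v\<^sup>2)"
  have "(r * ?V\<^sup>2)\<^sup>2 = (7 * ?V\<^sup>2 - 2 * (n * ?V) * ?V - (n * ?V)\<^sup>2)\<^sup>2 - 16 * ?V\<^sup>2 * (2 * ?V\<^sup>2 - 2 * (n * ?V)\<^sup>2)"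
    unfolding power_mult_distrib r by (simp add: power2_eq_square algebra_simps)
  also have "\<dots> = of_int (17 * (v\<^sup>2 * v\<^sup>2) + 3 * k)"
    unfolding n_times_v k_def by (simp add: power2_eq_square power3_eq_cube algebra_simps)
  finally have "(r * ?V\<^sup>2)\<^sup>2 = of_int (17 * (v\<^sup>2 * v\<^sup>2) + 3 * k)" .
  moreover have "(v\<^sup>2 * v\<^sup>2) mod 3 = 1"
    using v_square_mod by (metis mod_mult_eq mult_1 mod_mod_trivial)
  then have "(17 * (v\<^sup>2 * v\<^sup>2) + 3 * k) mod 3 = 2" by presburger
  ultimately show False using rat_square_not_2_mod_3 by blast
qed

end

section \<open>The family of quartics and the infinitude of its roots\<close>

definition quartic_equation :: "rat \<Rightarrow> complex \<Rightarrow> bool" where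
  "quartic_equation n \<alpha> \<longleftrightarrow>
     (\<alpha>\<^sup>2 + (1 - of_rat n) * \<alpha> + (2 - of_rat n))\<^sup>2 = 2 - 2 * (of_rat n)\<^sup>2"

lemma quartic_equation_solvable: "\<exists>\<alpha>. quartic_equation n \<alpha>"
proof -
  let ?n = "of_rat n :: complex"
  define p where "p = csqrt (2 - 2 * ?n\<^sup>2)"
  \<comment> \<open>The quadratic formula for
    \<open>\<alpha>\<^sup>2 + (1 - ?n) * \<alpha> + (2 - ?n) = p\<close>.\<close>
  define w where "w = csqrt ((1 - ?n)\<^sup>2 - 4 * (2 - ?n - p))"
  have "w\<^sup>2 = (1 - ?n)\<^sup>2 - 4 * (2 - ?n - p)" by (simp add: w_def)
  moreover define \<alpha> where "\<alpha> = (w - (1 - ?n)) / 2"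
  then have "w = 2 * \<alpha> + (1 - ?n)" by (simp add: algebra_simps)
  ultimately have "4 * (\<alpha>\<^sup>2 + (1 - ?n) * \<alpha> + (2 - ?n)) = 4 * p" by algebra
  then have "\<alpha>\<^sup>2 + (1 - ?n) * \<alpha> + (2 - ?n) = p" by (simp only: mult_cancel_left) simp
  moreover have "p\<^sup>2 = 2 - 2 * ?n\<^sup>2" by (simp add: p_def)
  ultimately show ?thesis unfolding quartic_equation_def by metis
qed

text \<open>For fixed \<open>\<alpha>\<close> the equation is a nonzero polynomial \<open>P\<close>
  of degree at most 2 in \<open>n\<close>. Hence infinitely many parameters produce infinitely many
  roots.\<close>

lemma finite_quartic_parameters: "finite {n. quartic_equation n \<alpha>}"
proof -
  define P where "P = [:(\<alpha>\<^sup>2 + \<alpha> + 2)\<^sup>2 - 2, - 2 * (\<alpha> + 1) * (\<alpha>\<^sup>2 + \<alpha> + 2), (\<alpha> + 1)\<^sup>2 + 2:]"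
  have "P \<noteq> 0"
  proof
    assume "P = 0"
    then have "(\<alpha>\<^sup>2 + \<alpha> + 2)\<^sup>2 = 2" "- 2 * (\<alpha> + 1) * (\<alpha>\<^sup>2 + \<alpha> + 2) = 0"
      and lead: "(\<alpha> + 1)\<^sup>2 + 2 = 0"
      unfolding P_def pCons_eq_0_iff by simp_all
    then have "\<alpha> + 1 = 0 \<or> \<alpha>\<^sup>2 + \<alpha> + 2 = 0" by (simp only: mult_eq_0_iff) simp
    with \<open>(\<alpha>\<^sup>2 + \<alpha> + 2)\<^sup>2 = 2\<close> have "\<alpha> + 1 = 0" by auto
    with lead have "(2 :: complex) = 0" by simp
    then show False by simp
  qed
  then have "finite {z. poly P z = 0}" by (rule poly_roots_finite)
  moreover have "(of_rat :: rat \<Rightarrow> complex) ` {n. quartic_equation n \<alpha>} \<subseteq> {z. poly P z = 0}"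
    by (auto simp: P_def quartic_equation_def power2_eq_square algebra_simps)
  ultimately have "finite ((of_rat :: rat \<Rightarrow> complex) ` {n. quartic_equation n \<alpha>})"
    using finite_subset by blast
  then show ?thesis by (rule finite_imageD) (simp add: inj_on_def)
qed

lemma infinite_quartic_solutions:
  assumes "infinite N" and "\<And>n \<alpha>. n \<in> N \<Longrightarrow> quartic_equation n \<alpha> \<Longrightarrow> \<alpha> \<in> S"
  shows "infinite S"
proof
  assume "finite S"
  then have "finite (\<Union>\<alpha>\<in>S. {n. quartic_equation n \<alpha>})"
    using finite_quartic_parameters by blast
  moreover have "N \<subseteq> (\<Union>\<alpha>\<in>S. {n. quartic_equation n \<alpha>})"
  proof
    fix n assume "n \<in> N"
    moreover obtain \<alpha> where "quartic_equation n \<alpha>" using quartic_equation_solvable by blast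
    ultimately show "n \<in> (\<Union>\<alpha>\<in>S. {n. quartic_equation n \<alpha>})" using assms(2) by blast
  qed
  ultimately show False using assms(1) finite_subset by blast
qed

section \<open>Degrees of \<open>\<alpha>\<close> and \<open>\<beta>\<close>, and reality of
  \<open>\<beta>\<close>\<close>

context quartic_parameter
begin

lemma algebraic_of_degree_4:
  assumes "quartic_equation n \<alpha>"
  shows "algebraic_of_degree 4 \<alpha>"
  unfolding algebraic_of_degree_def is_minimal_poly_rat_def
proof (intro exI conjI)
  define e f D where "e = 1 - n" and "f = 2 - n" and "D = 2 - 2 * n\<^sup>2"
  let ?F = "[:f\<^sup>2 - D, 2 * e * f, e\<^sup>2 + 2 * f, 2 * e, 1:]"
  show "irreducible ?F"
    using D_not_square disc_not_square unfolding e_def f_def D_def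
    by (intro irreducible_shifted_square) auto
  have "of_rat e = 1 - (of_rat n :: complex)" "of_rat f = 2 - (of_rat n :: complex)"
    "of_rat D = 2 - 2 * (of_rat n :: complex)\<^sup>2"
    by (simp_all add: e_def f_def D_def of_rat_diff of_rat_mult of_rat_power)
  then have "(\<alpha>\<^sup>2 + of_rat e * \<alpha> + of_rat f)\<^sup>2 = of_rat D"
    using assms by (simp add: quartic_equation_def)
  then show "poly (map_poly of_rat ?F) \<alpha> = 0"
    by (simp add: map_poly_pCons of_rat_diff of_rat_mult of_rat_power of_rat_add
        power2_eq_square algebra_simps)
qed simp_all

lemma n_neq_1: "n \<noteq> 1"
  using D_not_square[of 0] by auto

lemma one_plus_n_square_neq_0: "1 + n\<^sup>2 \<noteq> 0"
  using zero_le_power2[of n] by linarith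

text \<open>This keeps the denominators of \<open>beta_of\<close> nonzero. The values 1 and -1 would
  make \<open>2 - 2 * n\<^sup>2\<close> a square, and a square root of -1 would have to be
  rational.\<close>

lemma fourth_power_neq_1:
  assumes "quartic_equation n \<alpha>"
  shows "\<alpha> ^ 4 \<noteq> 1"
proof
  assume "\<alpha> ^ 4 = 1"
  then have "(\<alpha> - 1) * (\<alpha> + 1) * (\<alpha>\<^sup>2 + 1) = 0" by (simp add: power2_eq_square power4_eq_xxxx algebra_simps)
  then consider "\<alpha> = 1" | "\<alpha> = -1" | "\<alpha>\<^sup>2 = -1" by (auto simp: eq_neg_iff_add_eq_0)
  then show False
  proof cases
    case 1
    then have "(of_rat ((4 - 2 * n)\<^sup>2) :: complex) = of_rat (2 - 2 * n\<^sup>2)"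
      using assms by (simp add: quartic_equation_def of_rat_diff of_rat_mult of_rat_power algebra_simps)
    then show False using D_not_square of_rat_eq_iff by blast
  next
    case 2
    then have "(of_rat (2\<^sup>2) :: complex) = of_rat (2 - 2 * n\<^sup>2)"
      using assms by (simp add: quartic_equation_def of_rat_diff of_rat_mult of_rat_power algebra_simps)
    then show False using D_not_square of_rat_eq_iff by blast
  next
    case 3
    let ?n = "of_rat n :: complex"
    have "?n \<noteq> 1" using n_neq_1 by simp
    \<comment> \<open>With \<open>\<alpha>\<^sup>2 = -1\<close> the base of the square in the
      equation is \<open>(1 - ?n) * (\<alpha> + 1)\<close>, and
      \<open>(\<alpha> + 1)\<^sup>2 = 2 * \<alpha>\<close>.\<close>
    moreover have "(1 - ?n) * (2 * (1 - ?n) * \<alpha> - 2 * (1 + ?n)) = 0"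
      using assms 3 unfolding quartic_equation_def by algebra
    ultimately have "2 * (1 - ?n) * \<alpha> - 2 * (1 + ?n) = 0" by (simp only: mult_eq_0_iff) simp
    then have "2 * (\<alpha> * (1 - ?n)) = 2 * (1 + ?n)" by algebra
    then have "\<alpha> * (1 - ?n) = 1 + ?n" by (simp only: mult_cancel_left) simp
    then have "\<alpha> = (1 + ?n) / (1 - ?n)" using \<open>?n \<noteq> 1\<close> by (simp add: eq_divide_eq)
    also have "\<dots> = of_rat ((1 + n) / (1 - n))" by (simp add: of_rat_divide of_rat_add of_rat_diff)
    finally have "(of_rat (((1 + n) / (1 - n))\<^sup>2) :: complex) = of_rat (-1)"
      using 3 by (simp add: of_rat_power of_rat_minus)
    then have "((1 + n) / (1 - n))\<^sup>2 = -1" using of_rat_eq_iff by blast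
    moreover have "((1 + n) / (1 - n))\<^sup>2 \<ge> 0" by simp
    ultimately show False by simp
  qed
qed

text \<open>This writes \<open>\<beta>\<close> as \<open>A - B * p\<close> with rational
  \<open>A\<close>, \<open>B\<close> and \<open>p\<^sup>2 = 2 - 2 * n\<^sup>2\<close>, placing it in
  a quadratic field.\<close>

lemma beta_of_eq:
  assumes "quartic_equation n \<alpha>"
  shows "beta_of \<alpha> = of_rat ((2 - n + 3 * n\<^sup>2) / (1 + n\<^sup>2))
    - of_rat (1 / ((1 - n) * (1 + n\<^sup>2))) * (\<alpha>\<^sup>2 + (1 - of_rat n) * \<alpha> + (2 - of_rat n))"
proof -
  let ?n = "of_rat n :: complex"
  let ?p = "\<alpha>\<^sup>2 + (1 - ?n) * \<alpha> + (2 - ?n)"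
  let ?d = "\<alpha> ^ 3 + \<alpha>\<^sup>2 + \<alpha> + 1"
  have "1 - ?n \<noteq> 0" using n_neq_1 by simp
  moreover have "1 + ?n\<^sup>2 \<noteq> 0"
    using one_plus_n_square_neq_0 by (metis of_rat_1 of_rat_add of_rat_power of_rat_eq_0_iff)
  ultimately have nz: "1 - ?n \<noteq> 0" "1 + ?n\<^sup>2 \<noteq> 0" .
  have a4: "(\<alpha> - 1) * ?d = \<alpha> ^ 4 - 1" by algebra
  then have dz: "\<alpha> - 1 \<noteq> 0" "?d \<noteq> 0" "\<alpha> ^ 4 - 1 \<noteq> 0"
    using fourth_power_neq_1[OF assms] by auto
  have "\<alpha> / (\<alpha> - 1) = \<alpha> * ?d / (\<alpha> ^ 4 - 1)" using dz a4 by (simp add: frac_eq_eq mult_ac)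
  then have "beta_of \<alpha> = (4 * \<alpha> ^ 4 - \<alpha> * ?d) / (\<alpha> ^ 4 - 1)"
    by (simp add: beta_of_def diff_divide_distrib)
  also have "4 * \<alpha> ^ 4 - \<alpha> * ?d = (\<alpha> - 1) * (3 * \<alpha> ^ 3 + 2 * \<alpha>\<^sup>2 + \<alpha>)" by algebra
  also have "\<dots> / (\<alpha> ^ 4 - 1) = (3 * \<alpha> ^ 3 + 2 * \<alpha>\<^sup>2 + \<alpha>) / ?d"
    unfolding a4[symmetric] using dz by simp
  also have "\<dots> = ((2 - ?n + 3 * ?n\<^sup>2) * (1 - ?n) - ?p) / ((1 - ?n) * (1 + ?n\<^sup>2))"
  proof -
    \<comment> \<open>The cross-multiplied difference is a multiple of
      \<open>?p\<^sup>2 - (2 - 2 * ?n\<^sup>2)\<close>, which vanishes by the quartic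
      equation.\<close>
    have "(3 * \<alpha> ^ 3 + 2 * \<alpha>\<^sup>2 + \<alpha>) * ((1 - ?n) * (1 + ?n\<^sup>2)) - ((2 - ?n + 3 * ?n\<^sup>2) * (1 - ?n) - ?p) * ?d
      = (\<alpha> + ?n) * (?p\<^sup>2 - (2 - 2 * ?n\<^sup>2))" by algebra
    then show ?thesis using assms dz(2) nz by (simp add: frac_eq_eq quartic_equation_def)
  qed
  also have "\<dots> = of_rat ((2 - n + 3 * n\<^sup>2) / (1 + n\<^sup>2)) - of_rat (1 / ((1 - n) * (1 + n\<^sup>2))) * ?p"
    using nz by (simp add: of_rat_diff of_rat_mult of_rat_power of_rat_add of_rat_divide diff_divide_distrib)
  finally show ?thesis .
qed

lemma algebraic_of_degree_2_beta:
  assumes "quartic_equation n \<alpha>"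
  shows "algebraic_of_degree 2 (beta_of \<alpha>)"
  unfolding algebraic_of_degree_def is_minimal_poly_rat_def
proof (intro exI conjI)
  define A B D where "A = (2 - n + 3 * n\<^sup>2) / (1 + n\<^sup>2)" and "B = 1 / ((1 - n) * (1 + n\<^sup>2))"
    and "D = 2 - 2 * n\<^sup>2"
  let ?F = "[:A\<^sup>2 - B\<^sup>2 * D, - 2 * A, 1:]"
  have "B \<noteq> 0" using n_neq_1 one_plus_n_square_neq_0 by (simp add: B_def)
  have "r\<^sup>2 \<noteq> B\<^sup>2 * D" for r
  proof
    assume "r\<^sup>2 = B\<^sup>2 * D"
    then have "(r / B)\<^sup>2 = D" using \<open>B \<noteq> 0\<close> by (simp add: field_simps)
    then show False using D_not_square D_def by blast
  qed
  then show "irreducible ?F" by (rule irreducible_quadratic)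
  define p where "p = \<alpha>\<^sup>2 + (1 - of_rat n) * \<alpha> + (2 - of_rat n)"
  have "p\<^sup>2 = of_rat D"
    using assms by (simp add: quartic_equation_def D_def p_def of_rat_diff of_rat_mult of_rat_power)
  moreover have "beta_of \<alpha> = of_rat A - of_rat B * p"
    using beta_of_eq[OF assms] unfolding A_def B_def p_def .
  ultimately have "(beta_of \<alpha> - of_rat A)\<^sup>2 = (of_rat B)\<^sup>2 * of_rat D" by (simp add: power_mult_distrib)
  then show "poly (map_poly of_rat ?F) (beta_of \<alpha>) = 0"
    by (simp add: map_poly_pCons of_rat_diff of_rat_mult of_rat_power of_rat_minus
        power2_eq_square algebra_simps)
qed simp_all

text \<open>The bound makes \<open>2 - 2 * n\<^sup>2\<close> nonnegative, so its square root
  \<open>p\<close> is real.\<close>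

lemma beta_of_real:
  assumes "quartic_equation n \<alpha>" "\<bar>n\<bar> \<le> 1"
  shows "beta_of \<alpha> \<in> \<real>"
proof -
  define p where "p = \<alpha>\<^sup>2 + (1 - of_rat n) * \<alpha> + (2 - of_rat n)"
  define s where "s = sqrt (of_rat (2 - 2 * n\<^sup>2))"
  have "n\<^sup>2 \<le> 1" using assms(2) by (simp add: abs_square_le_1)
  then have "0 \<le> (of_rat (2 - 2 * n\<^sup>2) :: real)" by simp
  then have "s\<^sup>2 = of_rat (2 - 2 * n\<^sup>2)" by (simp add: s_def)
  then have "(complex_of_real s)\<^sup>2 = of_rat (2 - 2 * n\<^sup>2)"
    by (metis of_real_power of_real_of_rat)
  also have "\<dots> = p\<^sup>2"
    using assms(1) by (simp add: quartic_equation_def p_def of_rat_diff of_rat_mult of_rat_power)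
  finally have "p \<in> \<real>" by (metis power2_eq_iff Reals_of_real Reals_minus)
  moreover have "(of_rat q :: complex) \<in> \<real>" for q by (metis Reals_of_real of_real_of_rat)
  ultimately show ?thesis unfolding beta_of_eq[OF assms(1)] p_def[symmetric] by simp
qed

end

theorem theorem1p1:
  shows "infinite {\<alpha> :: complex.
           (\<exists>a b c d :: int. \<alpha> ^ 4 + of_int a * \<alpha> ^ 3 + of_int b * \<alpha> ^ 2 + of_int c * \<alpha> + of_int d = 0) \<and>
           algebraic_of_degree 4 \<alpha> \<and>
           algebraic_of_degree 2 (beta_of \<alpha>)} \<and>
         infinite {\<alpha> :: complex.
           algebraic_of_degree 4 \<alpha> \<and>
           beta_of \<alpha> \<in> \<real> \<and>
           algebraic_of_degree 2 (beta_of \<alpha>)}" (is "infinite ?S \<and> infinite ?T")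
proof
  show "infinite ?S"
  proof (rule infinite_quartic_solutions)
    \<comment> \<open>Integral \<open>n\<close> gives the quartic integer coefficients; here
      \<open>v = 1\<close>.\<close>
    show "infinite (range (\<lambda>k. of_int (3 * int k) :: rat))"
      by (rule range_inj_infinite) (simp add: inj_on_def)
    fix n \<alpha> assume "n \<in> range (\<lambda>k. of_int (3 * int k) :: rat)" and eq: "quartic_equation n \<alpha>"
    then obtain u where n: "n = of_int (3 * u)" by blast
    interpret quartic_parameter n u 1 by unfold_locales (auto simp: n)
    define m where "m = 3 * u"
    have "(\<alpha>\<^sup>2 + (1 - of_int m) * \<alpha> + (2 - of_int m))\<^sup>2 = 2 - 2 * (of_int m)\<^sup>2"
      using eq unfolding quartic_equation_def n m_def[symmetric] by simp
    then have "\<alpha> ^ 4 + of_int (2 * (1 - m)) * \<alpha> ^ 3 + of_int ((1 - m)\<^sup>2 + 2 * (2 - m)) * \<alpha> ^ 2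
        + of_int (2 * (1 - m) * (2 - m)) * \<alpha> + of_int ((2 - m)\<^sup>2 - 2 + 2 * m\<^sup>2) = 0"
      unfolding of_int_add of_int_mult of_int_diff of_int_power of_int_numeral of_int_1 by algebra
    then show "\<alpha> \<in> ?S"
      using algebraic_of_degree_4[OF eq] algebraic_of_degree_2_beta[OF eq] by blast
  qed
  show "infinite ?T"
  proof (rule infinite_quartic_solutions)
    \<comment> \<open>Here \<open>u = 1\<close>, and the denominator is 1 modulo 3 and exceeds 3, so
      that \<open>n\<close> lies between 0 and 1.\<close>
    show "infinite (range (\<lambda>k::nat. 3 / of_int (3 * int k + 4) :: rat))"
    proof (rule range_inj_infinite, rule injI)
      fix j k :: nat
      assume "(3 / of_int (3 * int j + 4) :: rat) = 3 / of_int (3 * int k + 4)"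
      then have "(of_int (3 * int j + 4) :: rat) = of_int (3 * int k + 4)" by simp
      then show "j = k" by simp
    qed
    fix n \<alpha> assume "n \<in> range (\<lambda>k::nat. 3 / of_int (3 * int k + 4) :: rat)"
      and eq: "quartic_equation n \<alpha>"
    then obtain k :: nat where n: "n = 3 / of_int (3 * int k + 4)" by blast
    interpret quartic_parameter n 1 "3 * int k + 4"
      by unfold_locales (simp add: n, presburger)
    have "\<bar>n\<bar> \<le> 1" by (simp add: n)
    then show "\<alpha> \<in> ?T"
      using algebraic_of_degree_4[OF eq] algebraic_of_degree_2_beta[OF eq] beta_of_real[OF eq] by blast
  qed
qed

end
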